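(* Let $(X,\triangleleft)$ be a rack with structure group $G=G(X,\triangleleft)$. Fix an $a\in X$, lying in the orbit $O_i$. For a word $w=g_{b_1}^{\epsilon_1}\cdots g_{b_n}^{\epsilon_n}$ ($b_t\in X$, $\epsilon_t\in\{1,-1\}$), let $p_a(w)\in Q_{2;i}(X,\triangleleft)$ be the class of its path sum starting at $a$. Then $p_a(w)$ depends only on the element of $G$ represented by $w$, so that one obtains a (set-theoretic) map $p_a\colon G(X,\triangleleft)\to Q_{2;i}(X,\triangleleft)$. This map restricts to a surjective group morphism $p'_a\colon G_a\twoheadrightarrow H_{2;i}(X,\triangleleft)$, where $G_a=\{g\in G: a\cdot g=a\}$ is the stabiliser subgroup of $a$ in $G$.
   Context: A rack is a set $X$ with a binary operation $\triangleleft$ such that $(a\triangleleft b)\triangleleft c=(a\triangleleft c)\triangleleft(b\triangleleft c)$ for all $a,b,c$, and each right translation $-\triangleleft b$ is a bijection of $X$; its inverse is denoted $-\mathbin{\widetilde{\triangleleft}}b$. The orbits $O_i$ are the orbits of $X$ under the group generated by all right translations. The structure group is $G(X,\triangleleft)=\langle g_a,\ a\in X\mid g_ag_b=g_bg_{a\triangleleft b},\ a,b\in X\rangle$; it acts on $X$ on the right by $a\cdot g_b=a\triangleleft b$. Homology. $C_k=\mathbb{Z}X^k$ with $d_k(a_1,\ldots,a_k)=\sum_{i=2}^k(-1)^{i-1}[(a_1,\ldots,\widehat{a_i},\ldots,a_k)-(a_1\triangleleft a_i,\ldots,a_{i-1}\triangleleft a_i,a_{i+1},\ldots,a_k)]$;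 so $d_2(a,b)=a\triangleleft b-a$ and $d_3(a,b,c)=(a\triangleleft b,c)-(a,c)-(a\triangleleft c,b\triangleleft c)+(a,b)$. The differentials preserve the decomposition $C_k=\bigoplus_i\mathbb{Z}(O_i\times X^{k-1})$; the $i$-th summand is $C_{k;i}$. Put $Z_{2;i}=\ker(d_2|_{C_{2;i}})$, $B_{2;i}=d_3(C_{3;i})$, $Q_{2;i}=C_{2;i}/B_{2;i}$ and $H_{2;i}=Z_{2;i}/B_{2;i}\subseteq Q_{2;i}$. Path sum. Given $a\in X$ and a word $w=g_{b_1}^{\epsilon_1}\cdots g_{b_n}^{\epsilon_n}$, put $a_0=a$ and, for $1\le t\le n$, $a_t=a_{t-1}\triangleleft b_t$ if $\epsilon_t=1$ and $a_t=a_{t-1}\mathbin{\widetilde{\triangleleft}}b_t$ if $\epsilon_t=-1$. The path sum of $w$ starting at $a$ is $\sum_{t=1}^ns_t\in C_{2;i}$, where $s_t=(a_{t-1},b_t)$ if $\epsilon_t=1$ and $s_t=-(a_t,b_t)$ if $\epsilon_t=-1$. For example, $w=g_bg_c^{-1}g_d$ has path sum $(a,b)-((a\triangleleft b)\mathbin{\widetilde{\triangleleft}}c,c)+((a\triangleleft b)\mathbin{\widetilde{\triangleleft}}c,d)$. *)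

theory Defs
  imports "HOL-Algebra.Group_Action" "HOL-Algebra.Free_Abelian_Groups"
begin

section \<open>Groups given by generators and relations\<close>

datatype 'b letter = Gen (base: 'b) | Inv (base: 'b)

type_synonym 'b word = "'b letter list"

definition words :: "'b set \<Rightarrow> 'b word set"
  where "words S = {w. base ` set w \<subseteq> S}"

text \<open>The monoid congruence on words over \<open>S\<close> generated by the relations \<open>R\<close> and by
  \<open>g g\<inverse> = 1 = g\<inverse> g\<close> for the generators \<open>g\<close>.\<close>

inductive_set word_cong :: "'b set \<Rightarrow> ('b word \<times> 'b word) set \<Rightarrow> ('b word \<times> 'b word) set"
  for S R where
    refl: "w \<in> words S \<Longrightarrow> (w, w) \<in> word_cong S R"
  | sym: "(u, v) \<in> word_cong S R \<Longrightarrow> (v, u) \<in> word_cong S R"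
  | trans: "(u, v) \<in> word_cong S R \<Longrightarrow> (v, w) \<in> word_cong S R \<Longrightarrow> (u, w) \<in> word_cong S R"
  | rel: "(r, s) \<in> R \<Longrightarrow> r \<in> words S \<Longrightarrow> s \<in> words S \<Longrightarrow> x \<in> words S \<Longrightarrow> y \<in> words S
      \<Longrightarrow> (x @ r @ y, x @ s @ y) \<in> word_cong S R"
  | Gen_Inv: "b \<in> S \<Longrightarrow> x \<in> words S \<Longrightarrow> y \<in> words S
      \<Longrightarrow> (x @ [Gen b, Inv b] @ y, x @ y) \<in> word_cong S R"
  | Inv_Gen: "b \<in> S \<Longrightarrow> x \<in> words S \<Longrightarrow> y \<in> words S
      \<Longrightarrow> (x @ [Inv b, Gen b] @ y, x @ y) \<in> word_cong S R"

definition presented_group :: "'b set \<Rightarrow> ('b word \<times> 'b word) set \<Rightarrow> 'b word set monoid"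
  where "presented_group S R =
    \<lparr>carrier = words S // word_cong S R,
     monoid.mult = (\<lambda>A B. \<Union>u\<in>A. \<Union>v\<in>B. word_cong S R `` {u @ v}),
     one = word_cong S R `` {[]}\<rparr>"

lemma words_Nil [simp]: "[] \<in> words S"
  by (simp add: words_def)

lemma words_append [simp]: "u @ v \<in> words S \<longleftrightarrow> u \<in> words S \<and> v \<in> words S"
  by (auto simp: words_def)

lemma words_Cons [simp]: "l # v \<in> words S \<longleftrightarrow> base l \<in> S \<and> v \<in> words S"
  by (auto simp: words_def)

lemma word_cong_words: "(u, v) \<in> word_cong S R \<Longrightarrow> u \<in> words S \<and> v \<in> words S"
  by (induction rule: word_cong.induct) auto

lemma equiv_word_cong: "equiv (words S) (word_cong S R)"
  by (rule equivI)
    (auto simp: refl_on_def sym_def trans_def dest: word_cong_words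
      intro: word_cong.refl word_cong.sym word_cong.trans)

lemma word_cong_context:
  assumes "(u, v) \<in> word_cong S R" "p \<in> words S" "q \<in> words S"
  shows "(p @ u @ q, p @ v @ q) \<in> word_cong S R"
  using assms
proof (induction rule: word_cong.induct)
  case (rel r s x y)
  then show ?case using word_cong.rel[of r s R S "p @ x" "y @ q"] by simp
next
  case (Gen_Inv b x y)
  then show ?case using word_cong.Gen_Inv[of b S "p @ x" "y @ q" R] by simp
next
  case (Inv_Gen b x y)
  then show ?case using word_cong.Inv_Gen[of b S "p @ x" "y @ q" R] by simp
qed (auto intro: word_cong.refl word_cong.sym word_cong.trans)

lemma word_cong_append:
  assumes "(u, u') \<in> word_cong S R" "(v, v') \<in> word_cong S R"
  shows "(u @ v, u' @ v') \<in> word_cong S R"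
proof -
  have "(u @ v, u' @ v) \<in> word_cong S R"
    using word_cong_context[OF assms(1), of "[]" v] word_cong_words[OF assms(2)] by simp
  moreover have "(u' @ v, u' @ v') \<in> word_cong S R"
    using word_cong_context[OF assms(2), of u' "[]"] word_cong_words[OF assms(1)] by simp
  ultimately show ?thesis by (rule word_cong.trans)
qed

lemma presented_group_mult:
  assumes "u \<in> words S" "v \<in> words S"
  shows "word_cong S R `` {u} \<otimes>\<^bsub>presented_group S R\<^esub> word_cong S R `` {v} = word_cong S R `` {u @ v}"
proof -
  have "congruent2 (word_cong S R) (word_cong S R) (\<lambda>u v. word_cong S R `` {u @ v})"
    by (intro congruent2I') (metis equiv_class_eq equiv_word_cong word_cong_append)
  then show ?thesis
    unfolding presented_group_def
    using UN_equiv_class2[OF equiv_word_cong equiv_word_cong _ assms] by simp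
qed

lemma word_inverse:
  assumes "w \<in> words S"
  shows "\<exists>v \<in> words S. (v @ w, []) \<in> word_cong S R"
  using assms
proof (induction w)
  case Nil
  show ?case by (rule bexI[of _ "[]"]) (auto intro: word_cong.refl)
next
  case (Cons l w)
  then obtain v where v: "v \<in> words S" "(v @ w, []) \<in> word_cong S R" by auto
  define m where "m = (case l of Gen b \<Rightarrow> Inv b | Inv b \<Rightarrow> Gen b)"
  have "(v @ [m, l] @ w, v @ w) \<in> word_cong S R"
    using Cons.prems v
    by (cases l) (auto simp: m_def intro!: word_cong.Gen_Inv[simplified] word_cong.Inv_Gen[simplified])
  then have "((v @ [m]) @ l # w, []) \<in> word_cong S R"
    using v(2) by (auto intro: word_cong.trans)
  moreover have "v @ [m] \<in> words S"
    using Cons.prems v by (auto simp: m_def split: letter.splits)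
  ultimately show ?case by blast
qed

lemma presented_group_carrierE:
  assumes "A \<in> carrier (presented_group S R)"
  obtains w where "w \<in> words S" "A = word_cong S R `` {w}"
  using assms by (auto simp: presented_group_def elim: quotientE)

lemma presented_group_class [simp]:
  "w \<in> words S \<Longrightarrow> word_cong S R `` {w} \<in> carrier (presented_group S R)"
  by (simp add: presented_group_def quotientI)

lemma group_presented_group: "group (presented_group S R)"
proof (rule groupI)
  have one: "\<one>\<^bsub>presented_group S R\<^esub> = word_cong S R `` {[]}"
    by (simp add: presented_group_def)
  show "\<one>\<^bsub>presented_group S R\<^esub> \<in> carrier (presented_group S R)"
    by (simp add: one)
  fix A assume "A \<in> carrier (presented_group S R)"
  then obtain u where u: "u \<in> words S" "A = word_cong S R `` {u}"
    by (rule presented_group_carrierE)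
  show "\<one>\<^bsub>presented_group S R\<^esub> \<otimes>\<^bsub>presented_group S R\<^esub> A = A"
    by (simp add: one u presented_group_mult)
  obtain v where v: "v \<in> words S" "(v @ u, []) \<in> word_cong S R"
    using word_inverse[OF u(1)] by blast
  have "word_cong S R `` {v} \<otimes>\<^bsub>presented_group S R\<^esub> A = \<one>\<^bsub>presented_group S R\<^esub>"
    by (simp add: one u v presented_group_mult equiv_class_eq[OF equiv_word_cong v(2)])
  with v show "\<exists>B\<in>carrier (presented_group S R).
      B \<otimes>\<^bsub>presented_group S R\<^esub> A = \<one>\<^bsub>presented_group S R\<^esub>"
    by (meson presented_group_class)
  fix B assume "B \<in> carrier (presented_group S R)"
  then obtain v where v: "v \<in> words S" "B = word_cong S R `` {v}"
    by (rule presented_group_carrierE)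
  show "A \<otimes>\<^bsub>presented_group S R\<^esub> B \<in> carrier (presented_group S R)"
    by (simp add: u v presented_group_mult)
  fix C assume "C \<in> carrier (presented_group S R)"
  then obtain w where w: "w \<in> words S" "C = word_cong S R `` {w}"
    by (rule presented_group_carrierE)
  show "A \<otimes>\<^bsub>presented_group S R\<^esub> B \<otimes>\<^bsub>presented_group S R\<^esub> C
      = A \<otimes>\<^bsub>presented_group S R\<^esub> (B \<otimes>\<^bsub>presented_group S R\<^esub> C)"
    by (simp add: u v w presented_group_mult)
qed


section \<open>Racks\<close>

locale rack =
  fixes X :: "'a set" and tri :: "'a \<Rightarrow> 'a \<Rightarrow> 'a"  (infixl \<open>\<triangleleft>\<close> 70)
  assumes closed: "\<lbrakk>a \<in> X; b \<in> X\<rbrakk> \<Longrightarrow> a \<triangleleft> b \<in> X"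
    and self_distrib: "\<lbrakk>a \<in> X; b \<in> X; c \<in> X\<rbrakk> \<Longrightarrow> (a \<triangleleft> b) \<triangleleft> c = (a \<triangleleft> c) \<triangleleft> (b \<triangleleft> c)"
    and bij_translation: "b \<in> X \<Longrightarrow> bij_betw (\<lambda>a. a \<triangleleft> b) X X"

definition rack_inv :: "'a set \<Rightarrow> ('a \<Rightarrow> 'a \<Rightarrow> 'a) \<Rightarrow> 'a \<Rightarrow> 'a \<Rightarrow> 'a"
  where "rack_inv X tri a b = inv_into X (\<lambda>x. tri x b) a"

definition translation_group :: "'a set \<Rightarrow> ('a \<Rightarrow> 'a \<Rightarrow> 'a) \<Rightarrow> ('a \<Rightarrow> 'a) monoid"
  where "translation_group X tri =
    subgroup_generated (BijGroup X) ((\<lambda>b. \<lambda>x\<in>X. tri x b) ` X)"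

definition rack_orbits :: "'a set \<Rightarrow> ('a \<Rightarrow> 'a \<Rightarrow> 'a) \<Rightarrow> 'a set set"
  where "rack_orbits X tri = orbits (translation_group X tri) X (\<lambda>f. f)"

definition structure_relations :: "'a set \<Rightarrow> ('a \<Rightarrow> 'a \<Rightarrow> 'a) \<Rightarrow> ('a word \<times> 'a word) set"
  where "structure_relations X tri =
    {([Gen a, Gen b], [Gen b, Gen (tri a b)]) | a b. a \<in> X \<and> b \<in> X}"

definition structure_group :: "'a set \<Rightarrow> ('a \<Rightarrow> 'a \<Rightarrow> 'a) \<Rightarrow> 'a word set monoid"
  where "structure_group X tri = presented_group X (structure_relations X tri)"

definition word_class :: "'a set \<Rightarrow> ('a \<Rightarrow> 'a \<Rightarrow> 'a) \<Rightarrow> 'a word \<Rightarrow> 'a word set"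
  where "word_class X tri w = word_cong X (structure_relations X tri) `` {w}"

fun letter_act :: "'a set \<Rightarrow> ('a \<Rightarrow> 'a \<Rightarrow> 'a) \<Rightarrow> 'a \<Rightarrow> 'a letter \<Rightarrow> 'a" where
  "letter_act X tri a (Gen b) = tri a b"
| "letter_act X tri a (Inv b) = rack_inv X tri a b"

definition word_act :: "'a set \<Rightarrow> ('a \<Rightarrow> 'a \<Rightarrow> 'a) \<Rightarrow> 'a \<Rightarrow> 'a word \<Rightarrow> 'a"
  where "word_act X tri a w = foldl (letter_act X tri) a w"

text \<open>The right action of the structure group: \<open>rack_act X tri g a\<close> is the element written
  \<open>a \<cdot> g\<close>. All words representing \<open>g\<close> send \<open>a\<close> to the same element,
  see \<open>rack_act_word_class\<close> below.\<close>

definition rack_act :: "'a set \<Rightarrow> ('a \<Rightarrow> 'a \<Rightarrow> 'a) \<Rightarrow> 'a word set \<Rightarrow> 'a \<Rightarrow> 'a"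
  where "rack_act X tri g a = the_elem (word_act X tri a ` g)"

definition rack_stabilizer :: "'a set \<Rightarrow> ('a \<Rightarrow> 'a \<Rightarrow> 'a) \<Rightarrow> 'a \<Rightarrow> 'a word set set"
  where "rack_stabilizer X tri a = stabilizer (structure_group X tri) (rack_act X tri) a"

context rack begin

lemma rack_inv_closed: "\<lbrakk>a \<in> X; b \<in> X\<rbrakk> \<Longrightarrow> rack_inv X tri a b \<in> X"
  unfolding rack_inv_def using bij_translation[of b] by (metis bij_betw_def inv_into_into)

lemma rack_inv_right: "\<lbrakk>a \<in> X; b \<in> X\<rbrakk> \<Longrightarrow> rack_inv X tri a b \<triangleleft> b = a"
  unfolding rack_inv_def using bij_betw_inv_into_right[OF bij_translation[of b]] by simp

lemma rack_inv_left: "\<lbrakk>a \<in> X; b \<in> X\<rbrakk> \<Longrightarrow> rack_inv X tri (a \<triangleleft> b) b = a"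
  unfolding rack_inv_def using bij_betw_inv_into_left[OF bij_translation[of b]] by simp

lemma letter_act_closed: "\<lbrakk>a \<in> X; base l \<in> X\<rbrakk> \<Longrightarrow> letter_act X tri a l \<in> X"
  by (cases l) (auto simp: closed rack_inv_closed)

lemma word_act_append: "word_act X tri a (u @ v) = word_act X tri (word_act X tri a u) v"
  by (simp add: word_act_def)

lemma word_act_closed: "\<lbrakk>a \<in> X; w \<in> words X\<rbrakk> \<Longrightarrow> word_act X tri a w \<in> X"
  by (induction w arbitrary: a) (auto simp: word_act_def letter_act_closed)

lemma word_act_cong:
  assumes "(u, v) \<in> word_cong X (structure_relations X tri)" "a \<in> X"
  shows "word_act X tri a u = word_act X tri a v"
  using assms
proof (induction arbitrary: a rule: word_cong.induct)
  case (rel r s x y)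
  then have "word_act X tri (word_act X tri a x) r = word_act X tri (word_act X tri a x) s"
    by (auto simp: structure_relations_def word_act_def[of _ _ _ "_ # _"] self_distrib word_act_closed)
  then show ?case by (simp add: word_act_append)
next
  case (Gen_Inv b x y)
  then show ?case
    by (simp add: word_act_def rack_inv_left word_act_closed[unfolded word_act_def])
next
  case (Inv_Gen b x y)
  then show ?case
    by (simp add: word_act_def rack_inv_right word_act_closed[unfolded word_act_def])
qed auto

lemma rack_act_word_class:
  assumes "a \<in> X" "w \<in> words X"
  shows "rack_act X tri (word_class X tri w) a = word_act X tri a w"
proof -
  have "word_act X tri a ` word_class X tri w = {word_act X tri a w}"
    using assms word_act_cong[OF _ assms(1)] word_cong.refl[OF assms(2)]
    unfolding word_class_def by (auto simp: image_iff)
  then show ?thesis by (simp add: rack_act_def)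
qed

end


section \<open>Rack homology\<close>

text \<open>The tuple \<open>(a\<^sub>1, \<dots>, a\<^sub>k)\<close> is encoded as a list of length \<open>k\<close>. List positions count
  from 0, so position \<open>i\<close> holds \<open>a\<close> with index \<open>i + 1\<close> and gets the sign \<open>(-1)^i\<close>.\<close>

definition rack_diff :: "('a \<Rightarrow> 'a \<Rightarrow> 'a) \<Rightarrow> ('a list \<Rightarrow>\<^sub>0 int) \<Rightarrow> ('a list \<Rightarrow>\<^sub>0 int)"
  where "rack_diff tri = frag_extend (\<lambda>xs. \<Sum>i = 1..<length xs. frag_cmul ((-1) ^ i)
    (frag_of (take i xs @ drop (Suc i) xs)
      - frag_of (map (\<lambda>x. tri x (xs ! i)) (take i xs) @ drop (Suc i) xs)))"

lemma rack_diff_2: "rack_diff tri (frag_of [a, b]) = frag_of [tri a b] - frag_of [a]"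
  by (simp add: rack_diff_def)

lemma rack_diff_3: "rack_diff tri (frag_of [a, b, c])
    = frag_of [tri a b, c] - frag_of [a, c] - frag_of [tri a c, tri b c] + frag_of [a, b]"
  by (simp add: rack_diff_def eval_nat_numeral)

text \<open>For an orbit \<open>Y\<close> and \<open>k \<ge> 1\<close>, the groups \<open>C\<close>, \<open>Z\<close>, \<open>B\<close>, \<open>Q = C / B\<close> and \<open>H = Z / B\<close> in
  degree \<open>k\<close> of the summand belonging to \<open>Y\<close>. Both quotients consist of cosets of \<open>B\<close>, so the
  carrier of \<open>H\<close> is a subset of that of \<open>Q\<close>.\<close>

definition rack_C :: "'a set \<Rightarrow> 'a set \<Rightarrow> nat \<Rightarrow> ('a list \<Rightarrow>\<^sub>0 int) monoid"
  where "rack_C X Y k = free_Abelian_group {xs. length xs = k \<and> set xs \<subseteq> X \<and> hd xs \<in> Y}"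

definition rack_Z :: "'a set \<Rightarrow> ('a \<Rightarrow> 'a \<Rightarrow> 'a) \<Rightarrow> 'a set \<Rightarrow> nat \<Rightarrow> ('a list \<Rightarrow>\<^sub>0 int) set"
  where "rack_Z X tri Y k = kernel (rack_C X Y k) (rack_C X Y (k - 1)) (rack_diff tri)"

definition rack_B :: "'a set \<Rightarrow> ('a \<Rightarrow> 'a \<Rightarrow> 'a) \<Rightarrow> 'a set \<Rightarrow> nat \<Rightarrow> ('a list \<Rightarrow>\<^sub>0 int) set"
  where "rack_B X tri Y k = rack_diff tri ` carrier (rack_C X Y (Suc k))"

definition rack_Q :: "'a set \<Rightarrow> ('a \<Rightarrow> 'a \<Rightarrow> 'a) \<Rightarrow> 'a set \<Rightarrow> nat \<Rightarrow> ('a list \<Rightarrow>\<^sub>0 int) set monoid"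
  where "rack_Q X tri Y k = rack_C X Y k Mod rack_B X tri Y k"

definition rack_H :: "'a set \<Rightarrow> ('a \<Rightarrow> 'a \<Rightarrow> 'a) \<Rightarrow> 'a set \<Rightarrow> nat \<Rightarrow> ('a list \<Rightarrow>\<^sub>0 int) set monoid"
  where "rack_H X tri Y k = (rack_C X Y k)\<lparr>carrier := rack_Z X tri Y k\<rparr> Mod rack_B X tri Y k"


section \<open>Path sums\<close>

fun path_sum :: "'a set \<Rightarrow> ('a \<Rightarrow> 'a \<Rightarrow> 'a) \<Rightarrow> 'a \<Rightarrow> 'a word \<Rightarrow> ('a list \<Rightarrow>\<^sub>0 int)" where
  "path_sum X tri a [] = 0"
| "path_sum X tri a (Gen b # w) = frag_of [a, b] + path_sum X tri (tri a b) w"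
| "path_sum X tri a (Inv b # w) =
     - frag_of [rack_inv X tri a b, b] + path_sum X tri (rack_inv X tri a b) w"

lemma "path_sum X tri a [Gen b, Inv c, Gen d] = frag_of [a, b]
    - frag_of [rack_inv X tri (tri a b) c, c] + frag_of [rack_inv X tri (tri a b) c, d]"
  by simp

definition path_class ::
    "'a set \<Rightarrow> ('a \<Rightarrow> 'a \<Rightarrow> 'a) \<Rightarrow> 'a set \<Rightarrow> 'a \<Rightarrow> 'a word \<Rightarrow> ('a list \<Rightarrow>\<^sub>0 int) set"
  where "path_class X tri Y a w = rack_B X tri Y 2 #>\<^bsub>rack_C X Y 2\<^esub> path_sum X tri a w"

end

theory Submission
  imports Defs
begin

text \<open>The path sum is additive along concatenation, and the two sides of a defining relation of the
  structure group differ by a value of \<open>d\<^sub>3\<close>, so path sums are invariant modulo boundaries. As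
  \<open>d\<^sub>2\<close> of a path sum is end point minus starting point, loops at \<open>a\<close> give cycles, and they do so
  additively. For surjectivity, choose for each \<open>y\<close> in the orbit a word \<open>u y\<close> leading from \<open>a\<close> to
  \<open>y\<close>. The map sending an edge \<open>(y, b)\<close> to the path sum of the loop
  \<open>u y \<cdot> g\<^sub>b \<cdot> (u (y \<triangleleft> b))\<inverse>\<close> extends linearly to all chains, and it is the identity on cycles,
  because the contributions of the chosen words cancel there. The path sums of loops form a
  subgroup, so every cycle is already the path sum of a loop.\<close>

section \<open>Formal inverses of words\<close>

fun inv_letter :: "'b letter \<Rightarrow> 'b letter" where
  "inv_letter (Gen b) = Inv b"
| "inv_letter (Inv b) = Gen b"

text \<open>A definite inverse, where \<open>word_inverse\<close> gives mere existence: the action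
  and the path sum of a reversed path have to be computed.\<close>

definition inv_word :: "'b word \<Rightarrow> 'b word"
  where "inv_word w = rev (map inv_letter w)"

lemma base_inv_letter [simp]: "base (inv_letter l) = base l"
  by (cases l) auto

lemma inv_word_Nil [simp]: "inv_word [] = []"
  by (simp add: inv_word_def)

lemma inv_word_Cons [simp]: "inv_word (l # w) = inv_word w @ [inv_letter l]"
  by (simp add: inv_word_def)

lemma inv_word_words [simp]: "inv_word w \<in> words S \<longleftrightarrow> w \<in> words S"
  by (induction w) auto

lemma inv_word_left_cong:
  assumes "w \<in> words S"
  shows "(inv_word w @ w, []) \<in> word_cong S R"
  using assms
proof (induction w)
  case (Cons l w)
  then have "(inv_word w @ [inv_letter l, l] @ w, inv_word w @ w) \<in> word_cong S R"
    by (cases l) (auto intro!: word_cong.Gen_Inv[simplified] word_cong.Inv_Gen[simplified])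
  with Cons show ?case by (auto intro: word_cong.trans)
qed (auto intro: word_cong.refl)

lemma presented_group_inv:
  assumes "w \<in> words S"
  shows "inv\<^bsub>presented_group S R\<^esub> (word_cong S R `` {w}) = word_cong S R `` {inv_word w}"
proof (rule group.inv_equality[OF group_presented_group])
  show "word_cong S R `` {inv_word w} \<otimes>\<^bsub>presented_group S R\<^esub> word_cong S R `` {w}
      = \<one>\<^bsub>presented_group S R\<^esub>"
    using assms equiv_class_eq[OF equiv_word_cong inv_word_left_cong[OF assms]]
    by (simp add: presented_group_mult) (simp add: presented_group_def)
qed (use assms in auto)

lemma (in rack) word_act_inv_word:
  "\<lbrakk>x \<in> X; w \<in> words X\<rbrakk> \<Longrightarrow> word_act X tri (word_act X tri x w) (inv_word w) = x"
proof (induction w arbitrary: x)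
  case (Cons l w)
  have "word_act X tri (word_act X tri x (l # w)) (inv_word (l # w))
      = word_act X tri (word_act X tri (word_act X tri (letter_act X tri x l) w) (inv_word w))
          [inv_letter l]"
    by (simp only: inv_word_Cons word_act_append) (simp add: word_act_def)
  also have "\<dots> = letter_act X tri (letter_act X tri x l) (inv_letter l)"
    using Cons letter_act_closed[of x l] by (simp add: word_act_def)
  also have "\<dots> = x"
    using Cons.prems by (cases l) (auto simp: rack_inv_left rack_inv_right)
  finally show ?case .
qed (simp add: word_act_def)

section \<open>Path sums under concatenation, reversal and the differential\<close>

lemma (in rack) path_sum_append:
  "path_sum X tri x (u @ v) = path_sum X tri x u + path_sum X tri (word_act X tri x u) v"
proof (induction u arbitrary: x)
  case (Cons l u)
  then show ?case by (cases l) (simp_all add: word_act_def)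
qed (simp add: word_act_def)

text \<open>A step \<open>Gen b\<close> records the point it leaves, a step \<open>Inv b\<close> the
  point it reaches. So a step run backwards meets the same generator with the opposite sign.\<close>

lemma (in rack) path_sum_inv_word:
  "\<lbrakk>x \<in> X; w \<in> words X\<rbrakk>
    \<Longrightarrow> path_sum X tri (word_act X tri x w) (inv_word w) = - path_sum X tri x w"
proof (induction w arbitrary: x)
  case (Cons l w)
  let ?x = "letter_act X tri x l"
  have x: "?x \<in> X" using Cons.prems by (simp add: letter_act_closed)
  have "word_act X tri x (l # w) = word_act X tri ?x w" by (simp add: word_act_def)
  \<comment> \<open>The reversed word first undoes \<open>w\<close>, which leads back to
    \<open>?x\<close>; its last letter then undoes \<open>l\<close>.\<close>
  then have "path_sum X tri (word_act X tri x (l # w)) (inv_word (l # w))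
      = - path_sum X tri ?x w + path_sum X tri ?x [inv_letter l]"
    using Cons x by (simp add: path_sum_append word_act_inv_word)
  also have "\<dots> = - path_sum X tri x (l # w)"
    using Cons.prems by (cases l) (auto simp: rack_inv_left rack_inv_right)
  finally show ?case .
qed simp

lemma rack_diff_add: "rack_diff tri (p + q) = rack_diff tri p + rack_diff tri q"
  by (simp add: rack_diff_def frag_extend_add)

lemma rack_diff_minus: "rack_diff tri (p - q) = rack_diff tri p - rack_diff tri q"
  by (simp add: rack_diff_def frag_extend_diff)

text \<open>The contributions of the steps telescope. For \<open>Inv b\<close> the recorded edge
  ends at \<open>x\<close> by \<open>rack_inv_right\<close>, and the minus sign turns it
  round.\<close>

lemma (in rack) rack_diff_path_sum:
  "\<lbrakk>x \<in> X; w \<in> words X\<rbrakk>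
    \<Longrightarrow> rack_diff tri (path_sum X tri x w) = frag_of [word_act X tri x w] - frag_of [x]"
proof (induction w arbitrary: x)
  case (Cons l w)
  show ?case
    using Cons.prems Cons.IH[OF letter_act_closed[of x l]]
    by (cases l) (simp_all add: rack_diff_add rack_diff_minus rack_diff_2 rack_inv_right word_act_def)
qed (simp add: rack_diff_def word_act_def)

section \<open>The translation group in terms of words\<close>

lemma (in rack) translation_Bij: "b \<in> X \<Longrightarrow> (\<lambda>x\<in>X. x \<triangleleft> b) \<in> Bij X"
  using bij_translation[of b] by (simp add: Bij_def bij_betw_def inj_on_def)

text \<open>\<open>subgroup_generated\<close> intersects the generators with the carrier; nothing is
  lost, because translations are bijections.\<close>

lemma (in rack) carrier_translation_group:
  "carrier (translation_group X tri) = generate (BijGroup X) ((\<lambda>b. \<lambda>x\<in>X. x \<triangleleft> b) ` X)"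
proof -
  have "carrier (BijGroup X) \<inter> (\<lambda>b. \<lambda>x\<in>X. x \<triangleleft> b) ` X = (\<lambda>b. \<lambda>x\<in>X. x \<triangleleft> b) ` X"
    using translation_Bij by (auto simp: BijGroup_def)
  then show ?thesis
    by (simp add: translation_group_def carrier_subgroup_generated)
qed

lemma (in rack) translation_inv:
  assumes "b \<in> X"
  shows "inv\<^bsub>BijGroup X\<^esub> (\<lambda>x\<in>X. x \<triangleleft> b) = (\<lambda>x\<in>X. rack_inv X tri x b)"
  unfolding inv_BijGroup[OF translation_Bij[OF assms]]
proof (rule restrict_ext)
  fix x assume x: "x \<in> X"
  have "inj_on (\<lambda>x\<in>X. x \<triangleleft> b) X"
    using bij_translation[OF assms] by (simp add: bij_betw_def inj_on_def)
  \<comment> \<open>The inverse is evaluated at \<open>x\<close>, seen as the translate of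
    \<open>rack_inv X tri x b\<close>.\<close>
  from inv_into_f_f[OF this rack_inv_closed[OF x assms]]
  show "inv_into X (\<lambda>x\<in>X. x \<triangleleft> b) x = rack_inv X tri x b"
    using x assms by (simp add: rack_inv_right rack_inv_closed)
qed

lemma (in rack) generated_translations_Bij:
  "f \<in> carrier (translation_group X tri) \<Longrightarrow> f \<in> Bij X"
  using group.generate_in_carrier[OF group_BijGroup, of "(\<lambda>b. \<lambda>x\<in>X. x \<triangleleft> b) ` X" X f]
    translation_Bij
  by (auto simp: carrier_translation_group) (auto simp: BijGroup_def)

text \<open>Together with \<open>word_translation_group\<close> this shows that words and
  translation group reach the same points.\<close>

lemma (in rack) translation_group_word:
  assumes "f \<in> carrier (translation_group X tri)"
  shows "\<exists>w \<in> words X. \<forall>x \<in> X. f x = word_act X tri x w"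
  using assms unfolding carrier_translation_group
proof (induction rule: generate.induct)
  case one
  show ?case by (rule bexI[of _ "[]"]) (auto simp: BijGroup_def word_act_def)
next
  case (incl h)
  then obtain b where "b \<in> X" "h = (\<lambda>x\<in>X. x \<triangleleft> b)" by auto
  then show ?case by (intro bexI[of _ "[Gen b]"]) (auto simp: word_act_def)
next
  case (inv h)
  then obtain b where "b \<in> X" "h = (\<lambda>x\<in>X. x \<triangleleft> b)" by auto
  then show ?case by (intro bexI[of _ "[Inv b]"]) (auto simp: word_act_def translation_inv)
next
  case (eng f g)
  then obtain u v where "u \<in> words X" "\<forall>x \<in> X. f x = word_act X tri x u"
    "v \<in> words X" "\<forall>x \<in> X. g x = word_act X tri x v" by blast
  moreover have "f \<in> Bij X" "g \<in> Bij X"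
    using eng.hyps generated_translations_Bij by (auto simp: carrier_translation_group)
  \<comment> \<open>The product of \<open>f\<close> and \<open>g\<close> in
    \<open>BijGroup X\<close> applies \<open>g\<close> first, whereas words act from left to right;
    hence \<open>v @ u\<close>.\<close>
  ultimately show ?case
    by (intro bexI[of _ "v @ u"])
      (auto simp: BijGroup_def compose_def word_act_append word_act_closed)
qed

lemma (in rack) word_translation_group:
  assumes "w \<in> words X"
  shows "(\<lambda>x\<in>X. word_act X tri x w) \<in> carrier (translation_group X tri)"
  using assms
proof (induction w)
  case Nil
  have "\<one>\<^bsub>BijGroup X\<^esub> = (\<lambda>x\<in>X. word_act X tri x [])"
    by (simp add: BijGroup_def word_act_def)
  from generate.one[of "BijGroup X", unfolded this] show ?case
    by (simp only: carrier_translation_group)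
next
  case (Cons l w)
  have "(\<lambda>x\<in>X. letter_act X tri x l) \<in> carrier (translation_group X tri)"
  proof (cases l)
    case (Gen b)
    then show ?thesis
      using Cons.prems by (auto simp: carrier_translation_group intro!: generate.incl)
  next
    case (Inv b)
    then show ?thesis
      using Cons.prems generate.inv[of "\<lambda>x\<in>X. x \<triangleleft> b" "(\<lambda>b. \<lambda>x\<in>X. x \<triangleleft> b) ` X" "BijGroup X"]
      by (auto simp: carrier_translation_group translation_inv)
  qed
  moreover have IH: "(\<lambda>x\<in>X. word_act X tri x w) \<in> carrier (translation_group X tri)"
    using Cons.prems by (intro Cons.IH) simp
  \<comment> \<open>The first letter acts first, so it becomes the right factor.\<close>
  ultimately have "(\<lambda>x\<in>X. word_act X tri x w) \<otimes>\<^bsub>BijGroup X\<^esub> (\<lambda>x\<in>X. letter_act X tri x l)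
      \<in> carrier (translation_group X tri)"
    unfolding carrier_translation_group by (intro generate.eng)
  moreover have "(\<lambda>x\<in>X. word_act X tri x w) \<otimes>\<^bsub>BijGroup X\<^esub> (\<lambda>x\<in>X. letter_act X tri x l)
      = (\<lambda>x\<in>X. word_act X tri x (l # w))"
    using generated_translations_Bij[OF IH] Cons.prems
      generated_translations_Bij[OF \<open>(\<lambda>x\<in>X. letter_act X tri x l) \<in> _\<close>]
    by (auto simp: BijGroup_def compose_def letter_act_closed word_act_def intro!: restrict_ext)
  ultimately show ?case by (simp only:)
qed

section \<open>The orbit as the set of end points of words\<close>

locale orbit_of_rack = rack +
  fixes Y :: "'a set"
  assumes orbit: "Y \<in> rack_orbits X tri"
begin

lemma orbit_words: obtains x where "x \<in> X" "Y = word_act X tri x ` words X"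
proof -
  obtain x where x: "x \<in> X" "Y = {f x | f. f \<in> carrier (translation_group X tri)}"
    using orbit by (auto simp: rack_orbits_def orbits_def orbit_def)
  have "Y = word_act X tri x ` words X"
  proof (intro equalityI subsetI)
    fix y assume "y \<in> word_act X tri x ` words X"
    then obtain w where w: "w \<in> words X" "y = (\<lambda>x\<in>X. word_act X tri x w) x" using x by auto
    then show "y \<in> Y"
      unfolding x(2) using word_translation_group[OF w(1)] by blast
  qed (use x translation_group_word in blast)
  with x(1) show thesis by (rule that)
qed

lemma orbit_subset: "Y \<subseteq> X"
  by (rule orbit_words) (auto simp: word_act_closed)

lemma orbit_closed: "\<lbrakk>y \<in> Y; w \<in> words X\<rbrakk> \<Longrightarrow> word_act X tri y w \<in> Y"
proof -
  assume y: "y \<in> Y" and w: "w \<in> words X"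
  obtain x where x: "Y = word_act X tri x ` words X" by (rule orbit_words)
  with y obtain u where u: "u \<in> words X" "y = word_act X tri x u" by auto
  then have "word_act X tri x (u @ w) \<in> Y" unfolding x using w by (intro imageI) simp
  with u show ?thesis by (simp add: word_act_append)
qed

lemma orbit_translate: "\<lbrakk>y \<in> Y; b \<in> X\<rbrakk> \<Longrightarrow> y \<triangleleft> b \<in> Y"
  using orbit_closed[of y "[Gen b]"] by (simp add: word_act_def)

lemma orbit_translate_inv: "\<lbrakk>y \<in> Y; b \<in> X\<rbrakk> \<Longrightarrow> rack_inv X tri y b \<in> Y"
  using orbit_closed[of y "[Inv b]"] by (simp add: word_act_def)

lemma orbit_connected:
  assumes "y \<in> Y" "z \<in> Y"
  obtains w where "w \<in> words X" "word_act X tri y w = z"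
proof -
  obtain x where x: "x \<in> X" "Y = word_act X tri x ` words X" by (rule orbit_words)
  with assms obtain u v where uv: "u \<in> words X" "y = word_act X tri x u"
    "v \<in> words X" "z = word_act X tri x v" by auto
  \<comment> \<open>From \<open>y\<close> back to the base point \<open>x\<close> along the reversed
    \<open>u\<close>, then out to \<open>z\<close> along \<open>v\<close>.\<close>
  then have "word_act X tri y (inv_word u @ v) = z"
    using x by (simp add: word_act_append word_act_inv_word)
  with uv show thesis by (intro that[of "inv_word u @ v"]) auto
qed

section \<open>Chain groups and differentials of the orbit summand\<close>

abbreviation tuples :: "nat \<Rightarrow> 'a list set"
  where "tuples k \<equiv> {xs. length xs = k \<and> set xs \<subseteq> X \<and> hd xs \<in> Y}"

lemma tuples_2E:
  assumes "xs \<in> tuples 2" obtains y b where "xs = [y, b]" "y \<in> Y" "b \<in> X"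
  using assms by (auto simp: length_Suc_conv eval_nat_numeral)

lemma tuples_3E:
  assumes "xs \<in> tuples 3" obtains y b c where "xs = [y, b, c]" "y \<in> Y" "b \<in> X" "c \<in> X"
  using assms by (auto simp: length_Suc_conv eval_nat_numeral)

lemma carrier_rack_C: "c \<in> carrier (rack_C X Y k) \<longleftrightarrow> Poly_Mapping.keys c \<subseteq> tuples k"
  by (simp add: rack_C_def)

lemma comm_group_C: "comm_group (rack_C X Y k)"
  by (simp add: rack_C_def abelian_free_Abelian_group)

lemma mult_C [simp]: "x \<otimes>\<^bsub>rack_C X Y k\<^esub> y = x + y"
  by (simp add: rack_C_def)

lemma one_C [simp]: "\<one>\<^bsub>rack_C X Y k\<^esub> = 0"
  by (simp add: rack_C_def)

text \<open>Additivity of \<open>frag_extend\<close> is automatic. The range can be tested on basis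
  elements, since the keys of \<open>frag_extend f c\<close> are among those of the
  \<open>f xs\<close> with \<open>xs\<close> a key of \<open>c\<close>.\<close>

lemma group_hom_frag_extend:
  assumes "\<And>xs. xs \<in> tuples k \<Longrightarrow> f xs \<in> carrier (rack_C X Y l)"
  shows "group_hom (rack_C X Y k) (rack_C X Y l) (frag_extend f)"
proof -
  have "frag_extend f c \<in> carrier (rack_C X Y l)" if "c \<in> carrier (rack_C X Y k)" for c
    using that assms keys_frag_extend[of f c] unfolding carrier_rack_C by blast
  then show ?thesis
    using comm_group_C
    by (auto simp: group_hom_def group_hom_axioms_def hom_def frag_extend_add comm_group_def)
qed

text \<open>The summand is preserved because \<open>y\<close> and \<open>y \<triangleleft> b\<close>
  lie in the same orbit.\<close>

lemma group_hom_rack_diff_2: "group_hom (rack_C X Y 2) (rack_C X Y 1) (rack_diff tri)"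
  unfolding rack_diff_def
proof (rule group_hom_frag_extend)
  fix xs assume "xs \<in> tuples 2"
  then obtain y b where xs: "xs = [y, b]" "y \<in> Y" "b \<in> X" by (rule tuples_2E)
  \<comment> \<open>The value on a basis element is written as \<open>rack_diff\<close> of a
    \<open>frag_of\<close>, so that \<open>rack_diff_2\<close> applies; the last unfolding restores
    the raw sum.\<close>
  have "Poly_Mapping.keys (rack_diff tri (frag_of [y, b])) \<subseteq> {[y \<triangleleft> b], [y]}"
    unfolding rack_diff_2 using keys_diff by fastforce
  also have "\<dots> \<subseteq> tuples 1"
    using xs orbit_translate[of y b] orbit_subset by auto
  finally show "(\<Sum>i = 1..<length xs. frag_cmul ((-1) ^ i)
    (frag_of (take i xs @ drop (Suc i) xs)
      - frag_of (map (\<lambda>x. tri x (xs ! i)) (take i xs) @ drop (Suc i) xs))) \<in> carrier (rack_C X Y 1)"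
    unfolding carrier_rack_C rack_diff_def frag_extend_of xs .
qed

lemma group_hom_rack_diff_3: "group_hom (rack_C X Y 3) (rack_C X Y 2) (rack_diff tri)"
  unfolding rack_diff_def
proof (rule group_hom_frag_extend)
  fix xs assume "xs \<in> tuples 3"
  then obtain y b c where xs: "xs = [y, b, c]" "y \<in> Y" "b \<in> X" "c \<in> X" by (rule tuples_3E)
  have "Poly_Mapping.keys (rack_diff tri (frag_of [y, b, c]))
      \<subseteq> {[y \<triangleleft> b, c], [y, c], [y \<triangleleft> c, b \<triangleleft> c], [y, b]}"
    unfolding rack_diff_3
    by (rule order_trans[OF keys_add] order_trans[OF keys_diff] Un_least | simp)+
  also have "\<dots> \<subseteq> tuples 2"
    using xs orbit_translate[of y] orbit_subset closed[of b c] by auto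
  finally show "(\<Sum>i = 1..<length xs. frag_cmul ((-1) ^ i)
    (frag_of (take i xs @ drop (Suc i) xs)
      - frag_of (map (\<lambda>x. tri x (xs ! i)) (take i xs) @ drop (Suc i) xs))) \<in> carrier (rack_C X Y 2)"
    unfolding carrier_rack_C rack_diff_def frag_extend_of xs .
qed

text \<open>On a basis element eight terms cancel in pairs; the pair
  \<open>(y \<triangleleft> b) \<triangleleft> c\<close> and
  \<open>(y \<triangleleft> c) \<triangleleft> (b \<triangleleft> c)\<close> cancels by
  self-distributivity.\<close>

lemma rack_diff_diff:
  assumes "c \<in> carrier (rack_C X Y 3)"
  shows "rack_diff tri (rack_diff tri c) = 0"
  using assms unfolding carrier_rack_C
proof (induction c rule: frag_induction)
  case (one xs)
  then obtain y b c where "xs = [y, b, c]" "y \<in> Y" "b \<in> X" "c \<in> X" by (rule tuples_3E)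
  then show ?case
    using self_distrib[of y b c] orbit_subset
    by (simp add: rack_diff_3 rack_diff_add rack_diff_minus rack_diff_2 subset_iff)
qed (simp_all add: rack_diff_def frag_extend_diff)

lemma subgroup_B: "subgroup (rack_B X tri Y 2) (rack_C X Y 2)"
  using group_hom.img_is_subgroup[OF group_hom_rack_diff_3] by (simp add: rack_B_def)

lemma subgroup_Z: "subgroup (rack_Z X tri Y 2) (rack_C X Y 2)"
  using group_hom.subgroup_kernel[OF group_hom_rack_diff_2] by (simp add: rack_Z_def)

lemma B_subset_Z: "rack_B X tri Y 2 \<subseteq> rack_Z X tri Y 2"
  using subgroup.subset[OF subgroup_B] rack_diff_diff
  by (auto simp: rack_B_def rack_Z_def kernel_def)

lemma normal_B_C: "rack_B X tri Y 2 \<lhd> rack_C X Y 2"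
  by (simp add: comm_group.subgroup_imp_normal comm_group_C subgroup_B)

text \<open>\<open>rack_H\<close> is a quotient of the group of cycles, so normality is needed
  inside that group too.\<close>

lemma normal_B_Z: "rack_B X tri Y 2 \<lhd> (rack_C X Y 2)\<lparr>carrier := rack_Z X tri Y 2\<rparr>"
  using comm_group_C
  by (intro group.normal_restrict_supergroup subgroup_Z normal_B_C B_subset_Z)
    (auto simp: comm_group_def)

section \<open>Invariance of path sums modulo boundaries\<close>

lemma path_sum_carrier:
  "\<lbrakk>y \<in> Y; w \<in> words X\<rbrakk> \<Longrightarrow> path_sum X tri y w \<in> carrier (rack_C X Y 2)"
proof (induction w arbitrary: y)
  case (Cons l w)
  interpret C: comm_group "rack_C X Y 2" by (rule comm_group_C)
  show ?case
  proof (cases l)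
    case (Gen b)
    with Cons have "frag_of [y, b] \<in> carrier (rack_C X Y 2)"
      "path_sum X tri (y \<triangleleft> b) w \<in> carrier (rack_C X Y 2)"
      using orbit_subset by (auto simp: carrier_rack_C orbit_translate)
    from C.m_closed[OF this] show ?thesis by (simp add: Gen)
  next
    case (Inv b)
    with Cons have "- frag_of [rack_inv X tri y b, b] \<in> carrier (rack_C X Y 2)"
      "path_sum X tri (rack_inv X tri y b) w \<in> carrier (rack_C X Y 2)"
      using orbit_subset by (auto simp: carrier_rack_C orbit_translate_inv rack_inv_closed)
    from C.m_closed[OF this] show ?thesis by (simp add: Inv)
  qed
qed (simp add: carrier_rack_C)

text \<open>The difference is exactly \<open>d_3\<close> of the triple
  \<open>[y, b, c]\<close>.\<close>

lemma path_sum_relation: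
  assumes "y \<in> Y" "b \<in> X" "c \<in> X"
  shows "path_sum X tri y [Gen b, Gen c] - path_sum X tri y [Gen c, Gen (b \<triangleleft> c)] \<in> rack_B X tri Y 2"
proof -
  have "frag_of [y, b, c] \<in> carrier (rack_C X Y 3)"
    using assms orbit_subset by (auto simp: carrier_rack_C)
  then have "rack_diff tri (frag_of [y, b, c]) \<in> rack_B X tri Y 2"
    by (simp add: rack_B_def)
  then show ?thesis by (simp add: rack_diff_3 algebra_simps)
qed

lemma path_sum_cong:
  assumes "(u, v) \<in> word_cong X (structure_relations X tri)" "y \<in> Y"
  shows "path_sum X tri y u - path_sum X tri y v \<in> rack_B X tri Y 2"
proof -
  note B = subgroup_B
  have zero: "0 \<in> rack_B X tri Y 2"
    using subgroup.one_closed[OF B] by simp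
  have add: "p + q \<in> rack_B X tri Y 2"
    if "p \<in> rack_B X tri Y 2" "q \<in> rack_B X tri Y 2" for p q
    using subgroup.m_closed[OF B that] by simp
  have uminus: "- p \<in> rack_B X tri Y 2" if "p \<in> rack_B X tri Y 2" for p
    using subgroup.m_inv_closed[OF B that] subgroup.mem_carrier[OF B that] by (simp add: rack_C_def)
  show ?thesis using assms
  proof (induction arbitrary: y rule: word_cong.induct)
    case (sym u v)
    then show ?case using uminus[of "path_sum X tri y u - path_sum X tri y v"] by simp
  next
    case (trans u v w)
    then show ?case
      using add[of "path_sum X tri y u - path_sum X tri y v"
          "path_sum X tri y v - path_sum X tri y w"] by simp
  next
    case (rel r s x z)
    let ?y = "word_act X tri y x"
    \<comment> \<open>Both sides of the relation lead to the same point, so the suffix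
      \<open>z\<close> contributes equally to both path sums and cancels, as does the
      prefix.\<close>
    have act: "word_act X tri ?y r = word_act X tri ?y s"
      using rel orbit_subset word_act_closed[of y x]
        word_act_cong[OF word_cong.rel[of r s _ X "[]" "[]"], of ?y] by auto
    obtain b c where "b \<in> X" "c \<in> X" "r = [Gen b, Gen c]" "s = [Gen c, Gen (b \<triangleleft> c)]"
      using rel by (auto simp: structure_relations_def)
    then have "path_sum X tri ?y r - path_sum X tri ?y s \<in> rack_B X tri Y 2"
      using path_sum_relation orbit_closed rel by blast
    then show ?case by (simp add: path_sum_append act)
  next
    case (Gen_Inv b x z)
    \<comment> \<open>One edge is run forth and back, so here the path sums agree already as
      chains.\<close>
    then have "word_act X tri y x \<in> X" using orbit_subset word_act_closed by blast
    then show ?case using Gen_Inv zero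
      by (simp add: path_sum_append rack_inv_left)
  next
    case (Inv_Gen b x z)
    then have "word_act X tri y x \<in> X" using orbit_subset word_act_closed by blast
    then show ?case using Inv_Gen zero
      by (simp add: path_sum_append rack_inv_right)
  qed (simp add: zero)
qed

lemma path_class_cong:
  assumes "(u, v) \<in> word_cong X (structure_relations X tri)" "y \<in> Y"
  shows "path_class X tri Y y u = path_class X tri Y y v"
  unfolding path_class_def
proof (rule group.repr_independence[symmetric])
  show "group (rack_C X Y 2)" using comm_group_C by (simp add: comm_group_def)
  \<comment> \<open>The coset element required is the difference of the two path sums.\<close>
  show "path_sum X tri y u \<in> rack_B X tri Y 2 #>\<^bsub>rack_C X Y 2\<^esub> path_sum X tri y v"
    using path_sum_cong[OF assms] by (force simp: r_coset_def)
  show "path_sum X tri y v \<in> carrier (rack_C X Y 2)"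
    using path_sum_carrier assms word_cong_words by blast
qed (rule subgroup_B)

section \<open>Cycles as path sums of loops\<close>

text \<open>The stabiliser at the level of words; see \<open>rack_stabilizer_loops\<close>.\<close>

definition loops :: "'a \<Rightarrow> 'a word set"
  where "loops y = {w \<in> words X. word_act X tri y w = y}"

lemma path_sum_loop_Z:
  "\<lbrakk>y \<in> Y; w \<in> loops y\<rbrakk> \<Longrightarrow> path_sum X tri y w \<in> rack_Z X tri Y 2"
  using orbit_subset path_sum_carrier
  by (auto simp: loops_def rack_Z_def kernel_def rack_diff_path_sum)

lemma Z_path_sum_loop:
  assumes "y \<in> Y" "z \<in> rack_Z X tri Y 2"
  shows "z \<in> path_sum X tri y ` loops y"
proof -
  have "\<exists>w. w \<in> words X \<and> word_act X tri y w = x" if "x \<in> Y" for x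
    using orbit_connected[OF assms(1) that] by blast
  then obtain u where u: "\<And>x. x \<in> Y \<Longrightarrow> u x \<in> words X" "\<And>x. x \<in> Y \<Longrightarrow> word_act X tri y (u x) = x"
    by metis
  \<comment> \<open>\<open>T\<close> depends on a vertex only. It takes lists so that it extends
    linearly to chains of degree 1, where \<open>d_2\<close> has its values.\<close>
  define T where "T xs = path_sum X tri y (u (hd xs))" for xs
  \<comment> \<open>On \<open>[x, b]\<close> this is the path sum of the loop that runs along
    \<open>u x\<close>, through the edge, and back along the reversed
    \<open>u (x \<triangleleft> b)\<close>.\<close>
  define L where "L xs = frag_of xs - T [hd xs \<triangleleft> (xs ! 1)] + T [hd xs]" for xs
  have y: "y \<in> X" using assms orbit_subset by blast
  have z: "Poly_Mapping.keys z \<subseteq> tuples 2" "rack_diff tri z = 0"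
    using assms(2) by (auto simp: rack_Z_def kernel_def carrier_rack_C)
  \<comment> \<open>\<open>frag_induction\<close> builds chains from basis elements by differences;
    a difference of path sums belongs to one loop followed by the reverse of the other.\<close>
  have diff: "p - q \<in> path_sum X tri y ` loops y"
    if pq: "p \<in> path_sum X tri y ` loops y" "q \<in> path_sum X tri y ` loops y" for p q
  proof -
    obtain v w where vw: "v \<in> loops y" "p = path_sum X tri y v" "w \<in> loops y" "q = path_sum X tri y w"
      using pq by blast
    have "word_act X tri y (inv_word w) = y" "path_sum X tri y (inv_word w) = - q"
      using vw word_act_inv_word[OF y, of w] path_sum_inv_word[OF y, of w] by (auto simp: loops_def)
    with vw have "v @ inv_word w \<in> loops y" "p - q = path_sum X tri y (v @ inv_word w)"
      by (auto simp: loops_def word_act_append path_sum_append)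
    then show ?thesis by blast
  qed
  have "frag_extend L z \<in> path_sum X tri y ` loops y"
    using z(1)
  proof (induction z rule: frag_induction)
    case zero
    show ?case by (rule image_eqI[of _ _ "[]"]) (auto simp: loops_def word_act_def)
  next
    case (one xs)
    then obtain x b where xs: "xs = [x, b]" "x \<in> Y" "b \<in> X" by (rule tuples_2E)
    let ?x = "x \<triangleleft> b"
    let ?w = "u x @ [Gen b] @ inv_word (u ?x)"
    have x': "?x \<in> Y" using xs orbit_translate by blast
    have "word_act X tri ?x (inv_word (u ?x)) = y"
      "path_sum X tri ?x (inv_word (u ?x)) = - path_sum X tri y (u ?x)"
      using word_act_inv_word[OF y u(1)[OF x']] path_sum_inv_word[OF y u(1)[OF x']] u(2)[OF x']
      by simp_all
    moreover have "word_act X tri x [Gen b] = ?x" by (simp add: word_act_def)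
    ultimately have "?w \<in> loops y" "path_sum X tri y ?w = L xs"
      using xs x' u by (simp_all add: loops_def word_act_append path_sum_append L_def T_def
        del: append_Cons append_Nil)
    then show ?case by (metis frag_extend_of image_eqI)
  qed (simp add: frag_extend_diff diff)
  \<comment> \<open>\<open>L\<close> is the identity minus \<open>T\<close> after
    \<open>d_2\<close>, so it fixes every cycle.\<close>
  moreover have "frag_extend L c = c - frag_extend T (rack_diff tri c)"
    if "Poly_Mapping.keys c \<subseteq> tuples 2" for c
    using that
  proof (induction c rule: frag_induction)
    case (one xs)
    then obtain x b where "xs = [x, b]" by (rule tuples_2E)
    then show ?case by (simp add: rack_diff_2 frag_extend_diff L_def)
  qed (simp_all add: rack_diff_def frag_extend_diff)
  ultimately show ?thesis using z by simp
qed

section \<open>Homology classes and the stabiliser\<close>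

text \<open>After the loop \<open>u\<close> the path along \<open>v\<close> starts at
  \<open>y\<close> again. The product is that of subsets of the chain group, which is the
  multiplication of cosets.\<close>

lemma path_class_append:
  assumes "y \<in> Y" "u \<in> loops y" "v \<in> words X"
  shows "path_class X tri Y y (u @ v) = path_class X tri Y y u <#>\<^bsub>rack_C X Y 2\<^esub> path_class X tri Y y v"
  using assms normal.rcos_sum[OF normal_B_C path_sum_carrier path_sum_carrier]
  by (simp add: loops_def path_class_def path_sum_append)

lemma path_class_carrier_Q:
  "\<lbrakk>y \<in> Y; w \<in> words X\<rbrakk> \<Longrightarrow> path_class X tri Y y w \<in> carrier (rack_Q X tri Y 2)"
  by (simp add: path_class_def rack_Q_def carrier_FactGroup path_sum_carrier)

lemma carrier_H_loops:
  assumes "y \<in> Y"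
  shows "carrier (rack_H X tri Y 2) = path_class X tri Y y ` loops y"
proof -
  \<comment> \<open>Restricting the carrier to cycles leaves the operation unchanged, so the cosets
    can be formed in the full chain group.\<close>
  have "carrier (rack_H X tri Y 2)
      = (\<lambda>z. rack_B X tri Y 2 #>\<^bsub>rack_C X Y 2\<^esub> z) ` rack_Z X tri Y 2"
    by (simp add: rack_H_def carrier_FactGroup r_coset_def)
  also have "rack_Z X tri Y 2 = path_sum X tri y ` loops y"
    using assms path_sum_loop_Z Z_path_sum_loop by blast
  finally show ?thesis by (simp add: path_class_def image_image)
qed

lemma rack_stabilizer_loops:
  assumes "y \<in> Y"
  shows "rack_stabilizer X tri y = word_class X tri ` loops y"
proof -
  have "y \<in> X" using assms orbit_subset by blast
  then have "rack_act X tri (word_class X tri w) y = word_act X tri y w" if "w \<in> words X" for w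
    using that by (rule rack_act_word_class)
  moreover have "carrier (structure_group X tri) = word_class X tri ` words X"
    unfolding structure_group_def presented_group_def quotient_def word_class_def by auto
  ultimately show ?thesis
    unfolding rack_stabilizer_def stabilizer_def loops_def by auto
qed

text \<open>\<open>rack_act\<close> is a right action and reverses products when read as a map into
  bijections, so closure is checked on representing loops.\<close>

lemma subgroup_rack_stabilizer:
  assumes "y \<in> Y"
  shows "subgroup (rack_stabilizer X tri y) (structure_group X tri)"
proof (rule group.subgroupI)
  have y: "y \<in> X" using assms orbit_subset by blast
  show "group (structure_group X tri)"
    by (simp add: structure_group_def group_presented_group)
  show "rack_stabilizer X tri y \<subseteq> carrier (structure_group X tri)"
    by (auto simp: rack_stabilizer_def stabilizer_def)
  have "[] \<in> loops y" by (simp add: loops_def word_act_def)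
  then show "rack_stabilizer X tri y \<noteq> {}"
    unfolding rack_stabilizer_loops[OF assms] by blast
next
  fix A assume "A \<in> rack_stabilizer X tri y"
  then obtain w where w: "w \<in> loops y" "A = word_class X tri w"
    unfolding rack_stabilizer_loops[OF assms] by blast
  then have "inv_word w \<in> loops y"
    using assms orbit_subset word_act_inv_word[of y w] by (auto simp: loops_def)
  moreover have "inv\<^bsub>structure_group X tri\<^esub> A = word_class X tri (inv_word w)"
    using w by (simp add: structure_group_def word_class_def presented_group_inv loops_def)
  ultimately show "inv\<^bsub>structure_group X tri\<^esub> A \<in> rack_stabilizer X tri y"
    unfolding rack_stabilizer_loops[OF assms] by blast
next
  fix A B assume "A \<in> rack_stabilizer X tri y" "B \<in> rack_stabilizer X tri y"
  then obtain u v where uv: "u \<in> loops y" "A = word_class X tri u"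
    "v \<in> loops y" "B = word_class X tri v"
    unfolding rack_stabilizer_loops[OF assms] by blast
  then have "u @ v \<in> loops y" "A \<otimes>\<^bsub>structure_group X tri\<^esub> B = word_class X tri (u @ v)"
    by (auto simp: loops_def word_act_append structure_group_def word_class_def presented_group_mult)
  then show "A \<otimes>\<^bsub>structure_group X tri\<^esub> B \<in> rack_stabilizer X tri y"
    unfolding rack_stabilizer_loops[OF assms] by blast
qed

end

theorem proposition6p1:
  fixes X :: "'a set" and tri :: "'a \<Rightarrow> 'a \<Rightarrow> 'a" and Y :: "'a set" and a :: 'a
  assumes "rack X tri"
    and "a \<in> X"
    and "Y \<in> rack_orbits X tri"
    and "a \<in> Y"
  shows "(\<forall>v \<in> words X. \<forall>w \<in> words X. word_class X tri v = word_class X tri w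
            \<longrightarrow> path_class X tri Y a v = path_class X tri Y a w)
    \<and> (\<exists>p \<in> carrier (structure_group X tri) \<rightarrow> carrier (rack_Q X tri Y 2).
          (\<forall>w \<in> words X. p (word_class X tri w) = path_class X tri Y a w)
        \<and> group_hom ((structure_group X tri)\<lparr>carrier := rack_stabilizer X tri a\<rparr>)
            (rack_H X tri Y 2) p
        \<and> p ` rack_stabilizer X tri a = carrier (rack_H X tri Y 2))"
proof -
  interpret rack X tri by fact
  interpret orbit_of_rack X tri Y by unfold_locales fact
  let ?R = "structure_relations X tri"
  have welldef: "path_class X tri Y a v = path_class X tri Y a w"
    if "v \<in> words X" "w \<in> words X" "word_class X tri v = word_class X tri w" for v w
    using that path_class_cong[OF _ \<open>a \<in> Y\<close>] eq_equiv_class[OF _ equiv_word_cong, of X ?R v w]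
    by (simp add: word_class_def)
  \<comment> \<open>By \<open>path_class_cong\<close> all words in a class have the same path class,
    so the image is a singleton and \<open>the_elem\<close> returns that value.\<close>
  define p where "p A = the_elem (path_class X tri Y a ` A)" for A
  have p: "p (word_class X tri w) = path_class X tri Y a w" if "w \<in> words X" for w
  proof -
    have "path_class X tri Y a ` word_class X tri w = {path_class X tri Y a w}"
      using path_class_cong[OF _ \<open>a \<in> Y\<close>] word_cong.refl[OF that]
      unfolding word_class_def by (auto simp: image_iff)
    then show ?thesis by (simp add: p_def)
  qed
  have "p \<in> carrier (structure_group X tri) \<rightarrow> carrier (rack_Q X tri Y 2)"
  proof
    fix A assume "A \<in> carrier (structure_group X tri)"
    then obtain w where "w \<in> words X" "A = word_class X tri w"
      unfolding structure_group_def word_class_def by (rule presented_group_carrierE)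
    with assms(4) show "p A \<in> carrier (rack_Q X tri Y 2)"
      by (simp add: p path_class_carrier_Q)
  qed
  \<comment> \<open>Loops at \<open>a\<close> represent the whole stabiliser and their path classes
    exhaust the homology group, which gives surjectivity.\<close>
  moreover have image: "p ` rack_stabilizer X tri a = carrier (rack_H X tri Y 2)"
    unfolding rack_stabilizer_loops[OF assms(4)] carrier_H_loops[OF assms(4)] image_image
    by (rule image_cong) (auto simp: p loops_def)
  moreover have "group_hom ((structure_group X tri)\<lparr>carrier := rack_stabilizer X tri a\<rparr>)
      (rack_H X tri Y 2) p"
  proof (intro group_hom.intro group_hom_axioms.intro homI)
    show "group ((structure_group X tri)\<lparr>carrier := rack_stabilizer X tri a\<rparr>)"
      using subgroup_rack_stabilizer[OF assms(4)]
      by (rule subgroup.subgroup_is_group) (simp add: structure_group_def group_presented_group)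
    show "group (rack_H X tri Y 2)"
      unfolding rack_H_def by (rule normal.factorgroup_is_group[OF normal_B_Z])
  next
    fix A assume "A \<in> carrier ((structure_group X tri)\<lparr>carrier := rack_stabilizer X tri a\<rparr>)"
    \<comment> \<open>The computed image also supplies the range condition.\<close>
    then show "p A \<in> carrier (rack_H X tri Y 2)" using image by auto
    fix B assume "B \<in> carrier ((structure_group X tri)\<lparr>carrier := rack_stabilizer X tri a\<rparr>)"
    with \<open>A \<in> _\<close> obtain u v where uv: "u \<in> loops a" "A = word_class X tri u"
      "v \<in> loops a" "B = word_class X tri v"
      unfolding rack_stabilizer_loops[OF assms(4)] by auto
    then have words: "u \<in> words X" "v \<in> words X" by (auto simp: loops_def)
    then have "A \<otimes>\<^bsub>structure_group X tri\<^esub> B = word_class X tri (u @ v)"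
      using uv by (simp add: structure_group_def word_class_def presented_group_mult)
    then show "p (A \<otimes>\<^bsub>(structure_group X tri)\<lparr>carrier := rack_stabilizer X tri a\<rparr>\<^esub> B)
        = p A \<otimes>\<^bsub>rack_H X tri Y 2\<^esub> p B"
      \<comment> \<open>\<open>set_mult\<close> does not refer to the carrier, so the product in
        \<open>rack_H\<close> is the one in \<open>path_class_append\<close>.\<close>
      using uv words path_class_append[OF assms(4) uv(1) words(2)]
      by (simp add: p rack_H_def set_mult_def)
  qed
  ultimately show ?thesis
    by (intro conjI bexI[of _ p] ballI impI welldef p)
qed

end
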